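(* Let $n\ge 1$ and let $\mathbf m=(m_1,\dots,m_{n+1})\in\mathbb Z^{n+1}$, $\mathbf k=(k_1,\dots,k_n)\in\mathbb Z^n$ satisfy $m_1\ge k_1\ge m_2\ge k_2\ge\cdots\ge m_n\ge k_n\ge m_{n+1}\ge 0$. Let $D$ be the Young diagram with $2n+1$ rows of lengths $m_1,k_1,m_2,k_2,\dots,m_n,k_n,m_{n+1}$. Perform the complete experiment on $D$ described in the context, which produces a random $n(n+1)/2$-tuple of diagrams in $S_{n+1}$. Then for every $1\le j\le n+1$, the probability that this tuple belongs to $S_{j,n+1}$ is $$a_j^2(\mathbf m,\mathbf k)=\left\vert\frac{\prod_{i=1}^{n}(k_i-m_j-i+j-1)}{\prod_{1\le i\le n+1,\ i\ne j}(m_i-m_j-i+j)}\right\vert .$$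
   Context: Notation. Row $2p-1$ of $D$ has $m_p$ boxes ($1\le p\le n+1$) and row $2p$ has $k_p$ boxes ($1\le p\le n$). $D+\mathbf e_i$ (resp. $D-\mathbf e_i$) denotes the diagram (array of rows) obtained from $D$ by adding (resp. deleting) one box in the $i$-th row. Elementary experiments. For $1\le k\le j\le n$, the experiment $E_{k,j}$ consists of choosing, uniformly at random among all the following possibilities, one operation on the rows $2k-1,2k,\dots,2j$ of $D$: for each $k\le p\le j$, inserting a box among the last $m_p-k_p$ boxes of the odd row $2p-1$ (there are $m_p-k_p+1$ possible insertion positions, to the left or right of these boxes), or deleting one of the last $k_p-m_{p+1}$ boxes of the even row $2p$ (there are $k_p-m_{p+1}$ possibilities). The outcome of $E_{k,j}$ is the resulting diagram, $D+\mathbf e_{2p-1}$ or $D-\mathbf e_{2p}$ respectively. All experiments start from the same diagram $D$ and are independent. Complete experiment. The experiments $E_{k,j}$, $1\le k\le j\le n$, are ordered by $E_{k,j}<E_{r,s}$ if $j<s$, or if $j=s$ and $r<k$; that is, $E_{1,1},E_{2,2},E_{1,2},E_{3,3},E_{2,3},E_{1,3},\dots,E_{n,n},E_{n-1,n},\dots,E_{1,n}$. The complete experiment performs all of them in this order and records the $n(n+1)/2$-tuple of outcomes. Sample space. $S_{n+1}$ is the set of $n(n+1)/2$-tuples of possible outcomes of the experiments $E_{k,j}$, $1\le k\le j\le n$, in this order. $S_n$ denotes likewise the set of $n(n-1)/2$-tuples of possible outcomes of the experiments $E_{k,j}$, $1\le k\le j\le n-1$; an element of $S_{n+1}$ is an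 element of $S_n$ followed by the outcomes of $E_{n,n},E_{n-1,n},\dots,E_{1,n}$. The subsets $S_{j,n+1}$ are defined inductively. $S_{1,2}$ is the set of outcomes of $E_{1,1}$ equal to $D+\mathbf e_1$, and $S_{2,2}$ is the set of outcomes of $E_{1,1}$ equal to $D-\mathbf e_2$ (empty if $k_1=m_2$). For $n\ge2$ and $1\le j\le n$, $S_{j,n+1}$ is the set of tuples in $S_{n+1}$ whose first $n(n-1)/2$ entries form an element of $S_{j,n}$ and whose entry coming from $E_{j,n}$ is different from $D-\mathbf e_{2n}$ (the other entries are arbitrary). Finally, $S_{n+1,n+1}$ is the union over $1\le j\le n$ of the sets of tuples in $S_{n+1}$ whose first $n(n-1)/2$ entries form an element of $S_{j,n}$ and whose entry coming from $E_{j,n}$ equals $D-\mathbf e_{2n}$. *)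

theory Defs
  imports "HOL-Probability.Probability" "HOL-Probability.Product_PMF"
begin

text \<open>
  A diagram is the list of its row lengths; it need not be a partition, since adding a box to a
  row of a Young diagram may make it longer than the row above. Row numbers are 1-based.
\<close>

type_synonym diagram = "int list"

definition row_len :: "diagram \<Rightarrow> nat \<Rightarrow> int" where
  "row_len D i = D ! (i - 1)"

definition add_box :: "diagram \<Rightarrow> nat \<Rightarrow> diagram" where
  "add_box D i = D[i - 1 := row_len D i + 1]"

definition delete_box :: "diagram \<Rightarrow> nat \<Rightarrow> diagram" where
  "delete_box D i = D[i - 1 := row_len D i - 1]"

text \<open>
  The rows \<open>m\<^sub>1, k\<^sub>1, m\<^sub>2, k\<^sub>2, \<dots>, m\<^sub>n, k\<^sub>n, m\<^sub>n\<^sub>+\<^sub>1\<close>. Only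
  \<open>m 1, \<dots>, m (n + 1)\<close> and \<open>k 1, \<dots>, k n\<close> are used.
\<close>

definition interlaced_diagram :: "nat \<Rightarrow> (nat \<Rightarrow> int) \<Rightarrow> (nat \<Rightarrow> int) \<Rightarrow> diagram" where
  "interlaced_diagram n m k = concat (map (\<lambda>p. [m p, k p]) [1..<n + 1]) @ [m (n + 1)]"

text \<open>
  \<open>Insert p c\<close> inserts a box into row \<open>2 * p - 1\<close> immediately after its first \<open>c\<close> boxes;
  \<open>Delete p c\<close> deletes the \<open>c\<close>-th box of row \<open>2 * p\<close>.
\<close>

datatype operation = Insert nat int | Delete nat int

fun outcome :: "diagram \<Rightarrow> operation \<Rightarrow> diagram" where
  "outcome D (Insert p c) = add_box D (2 * p - 1)"
| "outcome D (Delete p c) = delete_box D (2 * p)"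

text \<open>
  With \<open>m p = row_len D (2 * p - 1)\<close> and \<open>k p = row_len D (2 * p)\<close>, there are \<open>m p - k p + 1\<close>
  insertions, namely those to the left or right of the last \<open>m p - k p\<close> boxes of the odd row, and
  \<open>k p - m (p + 1)\<close> deletions, namely of the last boxes of the even row.
\<close>

definition operations :: "diagram \<Rightarrow> nat \<Rightarrow> nat \<Rightarrow> operation set" where
  "operations D k j =
     (\<Union>p\<in>{k..j}. Insert p ` {row_len D (2 * p)..row_len D (2 * p - 1)} \<union>
                Delete p ` {row_len D (2 * p + 1)<..row_len D (2 * p)})"

definition elementary_experiment :: "diagram \<Rightarrow> nat \<Rightarrow> nat \<Rightarrow> diagram pmf" where
  "elementary_experiment D k j = map_pmf (outcome D) (pmf_of_set (operations D k j))"

text \<open>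
  The pairs \<open>(k, j)\<close> with \<open>1 \<le> k \<le> j \<le> n\<close> in the order
  \<open>(1, 1), (2, 2), (1, 2), (3, 3), (2, 3), (1, 3), \<dots>, (n, n), \<dots>, (1, n)\<close>.
\<close>

definition experiment_order :: "nat \<Rightarrow> (nat \<times> nat) list" where
  "experiment_order n = concat (map (\<lambda>j. map (\<lambda>k. (k, j)) (rev [1..<j + 1])) [1..<n + 1])"

definition complete_experiment :: "diagram \<Rightarrow> nat \<Rightarrow> diagram list pmf" where
  "complete_experiment D n =
     map_pmf (\<lambda>\<omega>. map \<omega> (experiment_order n))
       (Pi_pmf (set (experiment_order n)) undefined (\<lambda>(k, j). elementary_experiment D k j))"

text \<open>
  The set \<open>S\<^sub>n\<^sub>+\<^sub>1\<close> of tuples of possible outcomes of the experiments with \<open>1 \<le> k \<le> j \<le> n\<close>.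
  Note the shift in the index.
\<close>

definition sample_space :: "diagram \<Rightarrow> nat \<Rightarrow> diagram list set" where
  "sample_space D n =
     listset (map (\<lambda>(k, j). outcome D ` operations D k j) (experiment_order n))"

text \<open>The entry of a tuple \<open>xs\<close> in \<open>S\<^sub>n\<^sub>+\<^sub>1\<close> that comes from the experiment \<open>(k, j)\<close>.\<close>

definition entry :: "nat \<Rightarrow> diagram list \<Rightarrow> nat \<Rightarrow> nat \<Rightarrow> diagram" where
  "entry n xs k j = the (map_of (zip (experiment_order n) xs) (k, j))"

text \<open>
  \<open>sample_part D n j\<close> is the set \<open>S\<^sub>j\<^sub>,\<^sub>n\<^sub>+\<^sub>1\<close>, defined for \<open>n \<ge> 1\<close> and \<open>1 \<le> j \<le> n + 1\<close>; the value
  in all other cases is the empty set. The diagram \<open>D\<close> is the same at every level of the recursion.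
\<close>

fun sample_part :: "diagram \<Rightarrow> nat \<Rightarrow> nat \<Rightarrow> diagram list set" where
  "sample_part D 0 j = {}"
| "sample_part D (Suc 0) j =
     (if j = 1 then {xs \<in> sample_space D 1. entry 1 xs 1 1 = add_box D 1}
      else if j = 2 then {xs \<in> sample_space D 1. entry 1 xs 1 1 = delete_box D 2}
      else {})"
| "sample_part D (Suc (Suc l)) j =
     (let n = Suc (Suc l) in
      if 1 \<le> j \<and> j \<le> n then
        {xs \<in> sample_space D n.
           take (n * (n - 1) div 2) xs \<in> sample_part D (Suc l) j \<and>
           entry n xs j n \<noteq> delete_box D (2 * n)}
      else if j = n + 1 then
        (\<Union>i\<in>{1..n}. {xs \<in> sample_space D n.
           take (n * (n - 1) div 2) xs \<in> sample_part D (Suc l) i \<and>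
           entry n xs i n = delete_box D (2 * n)})
      else {})"

end

theory Submission
  imports Defs
begin

text \<open>
  Put \<open>x\<^sub>i = m\<^sub>i - i\<close> and \<open>y\<^sub>i = k\<^sub>i - i - 1\<close>, so that \<open>x\<^sub>1 > y\<^sub>1 \<ge> x\<^sub>2 > y\<^sub>2 \<ge> \<dots>\<close>. The experiment
  \<open>E\<^sub>a\<^sub>,\<^sub>l\<close> has \<open>x\<^sub>a - x\<^sub>l\<^sub>+\<^sub>1\<close> equally likely operations, of which \<open>y\<^sub>l - x\<^sub>l\<^sub>+\<^sub>1\<close> delete a box from row
  \<open>2l\<close>. The index \<open>j\<close> of the part containing the tuple is therefore a Markov chain: it starts at \<open>1\<close>,
  and in step \<open>l\<close> it jumps from \<open>a\<close> to \<open>l + 1\<close> with probability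
  \<open>(y\<^sub>l - x\<^sub>l\<^sub>+\<^sub>1) / (x\<^sub>a - x\<^sub>l\<^sub>+\<^sub>1)\<close> and stays at \<open>a\<close> otherwise. That the claimed weights satisfy the
  same recursion is immediate for \<open>j \<le> l\<close>; for \<open>j = l + 1\<close> it is the partial fraction expansion of
  \<open>\<Prod>(y\<^sub>i - z) / \<Prod>(x\<^sub>i - z)\<close> at \<open>z = x\<^sub>l\<^sub>+\<^sub>1\<close>. The weights, being probabilities, are
  nonnegative, which accounts for the absolute value.
\<close>

section \<open>Partial fractions for the weights\<close>

definition interlacing_weight ::
    "(nat \<Rightarrow> 'a::field) \<Rightarrow> (nat \<Rightarrow> 'a) \<Rightarrow> nat \<Rightarrow> nat \<Rightarrow> 'a" where
  "interlacing_weight x y n j =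
     (\<Prod>i\<in>{1..n}. y i - x j) / (\<Prod>i\<in>{1..n + 1} - {j}. x i - x j)"

lemma interlacing_weight_0: "interlacing_weight x y 0 1 = 1"
  by (simp add: interlacing_weight_def)

lemma interlacing_weight_Suc:
  assumes "1 \<le> j" "j \<le> n + 1"
  shows "interlacing_weight x y (Suc n) j =
    interlacing_weight x y n j * ((y (Suc n) - x j) / (x (n + 2) - x j))"
proof -
  have "{1..Suc n + 1} - {j} = insert (n + 2) ({1..n + 1} - {j})"
    using assms by auto
  then show ?thesis
    by (simp add: interlacing_weight_def)
qed

lemma interlacing_weight_Suc_last:
  "interlacing_weight x y (Suc n) (n + 2) =
    (y (Suc n) - x (n + 2)) *
      ((\<Prod>i\<in>{1..n}. y i - x (n + 2)) / (\<Prod>i\<in>{1..n + 1}. x i - x (n + 2)))"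
proof -
  have "{1..Suc n + 1} - {n + 2} = {1..n + 1}"
    by auto
  then show ?thesis
    by (simp add: interlacing_weight_def)
qed

text \<open>Partial fractions in \<open>t\<close>: the poles are \<open>z\<close> and
  \<open>w\<close>, with residues \<open>(v - z) / (w - z)\<close> and
  \<open>- (v - w) / (w - z)\<close> up to the factor \<open>a\<close>.\<close>

lemma divide_linear_split:
  fixes t v w z a :: "'a::field"
  assumes "w \<noteq> z" "t \<noteq> z" "t \<noteq> w"
  shows "a * ((v - t) / (w - t)) / (t - z) =
    (v - z) / (w - z) * (a / (t - z)) - (v - w) / (w - z) * (a / (t - w))"
proof -
  \<comment> \<open>In these variables \<open>v - z = s + p\<close>, \<open>v - w = s + q\<close>
    and \<open>w - z = p - q\<close>.\<close>
  define p q s where "p = t - z" and "q = t - w" and "s = v - t"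
  have nz: "p \<noteq> 0" "q \<noteq> 0" "p - q \<noteq> 0"
    using assms by (auto simp: p_def q_def)
  have "(s + p) / (p - q) * (a / p) - (s + q) / (p - q) * (a / q) =
      (s * a + p * a) / ((p - q) * p) - (s * a + q * a) / ((p - q) * q)"
    by (simp add: algebra_simps)
  also have "\<dots> = a * (s / - q) / p"
    using nz by (simp add: divide_simps) (simp add: algebra_simps)
  finally show ?thesis
    by (simp add: p_def q_def s_def)
qed

text \<open>The weights are the coefficients at the simple poles \<open>z = x j\<close>. The
  induction keeps \<open>z\<close> arbitrary because its step needs the hypothesis both at
  \<open>z\<close> and at the new node \<open>x (n + 2)\<close>.\<close>

lemma interlacing_weight_partial_fractions:
  assumes "inj_on x {1..n + 1}" "\<And>i. i \<in> {1..n + 1} \<Longrightarrow> x i \<noteq> z"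
  shows "(\<Sum>j\<in>{1..n + 1}. interlacing_weight x y n j / (x j - z)) =
    (\<Prod>i\<in>{1..n}. y i - z) / (\<Prod>i\<in>{1..n + 1}. x i - z)"
  using assms
proof (induction n arbitrary: z)
  case 0
  then show ?case
    using interlacing_weight_0[of x y] by simp
next
  case (Suc n)
  define w v where "w = x (n + 2)" and "v = y (Suc n)"
  define F where
    "F = (\<lambda>z. \<Sum>j\<in>{1..n + 1}. interlacing_weight x y n j / (x j - z))"
  have inj: "inj_on x {1..n + 1}"
    using Suc.prems(1) by (rule inj_on_subset) auto
  have xw: "x i \<noteq> w" if "i \<in> {1..n + 1}" for i
    using Suc.prems(1) that unfolding w_def by (auto dest: inj_onD)
  have xz: "x i \<noteq> z" if "i \<in> {1..n + 1}" for i
    using Suc.prems(2) that by simp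
  have wz: "w \<noteq> z"
    using Suc.prems(2)[of "n + 2"] by (simp add: w_def)
  have Fz: "F z = (\<Prod>i\<in>{1..n}. y i - z) / (\<Prod>i\<in>{1..n + 1}. x i - z)"
    unfolding F_def using Suc.IH[OF inj xz] .
  have Fw: "F w = (\<Prod>i\<in>{1..n}. y i - w) / (\<Prod>i\<in>{1..n + 1}. x i - w)"
    unfolding F_def using Suc.IH[OF inj xw] .
  \<comment> \<open>Separating the poles turns the sum over the old nodes into a combination of
    \<open>F z\<close> and \<open>F w\<close>.\<close>
  have split: "interlacing_weight x y (Suc n) j / (x j - z) =
      (v - z) / (w - z) * (interlacing_weight x y n j / (x j - z))
      - (v - w) / (w - z) * (interlacing_weight x y n j / (x j - w))"
    if j: "j \<in> {1..n + 1}" for j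
  proof -
    show ?thesis
      using interlacing_weight_Suc[of j n x y] j wz
        divide_linear_split[of w z "x j" "interlacing_weight x y n j" v] xz[OF j] xw[OF j]
      by (simp add: v_def w_def)
  qed
  have "{1..Suc n + 1} = insert (n + 2) {1..n + 1}"
    by auto
  then have "(\<Sum>j\<in>{1..Suc n + 1}. interlacing_weight x y (Suc n) j / (x j - z)) =
      interlacing_weight x y (Suc n) (n + 2) / (w - z)
      + (\<Sum>j\<in>{1..n + 1}. interlacing_weight x y (Suc n) j / (x j - z))"
    by (simp add: w_def)
  also have "interlacing_weight x y (Suc n) (n + 2) = (v - w) * F w"
    unfolding interlacing_weight_Suc_last Fw by (simp add: v_def w_def)
  also have "(\<Sum>j\<in>{1..n + 1}. interlacing_weight x y (Suc n) j / (x j - z)) =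
      (v - z) / (w - z) * F z - (v - w) / (w - z) * F w"
    unfolding F_def sum_distrib_left sum_subtractf[symmetric] by (rule sum.cong) (auto simp: split)
  \<comment> \<open>The summand of the new node cancels the \<open>F w\<close> term.\<close>
  also have "(v - w) * F w / (w - z) + ((v - z) / (w - z) * F z - (v - w) / (w - z) * F w) =
      (v - z) / (w - z) * F z"
    by simp
  also have "\<dots> = (\<Prod>i\<in>{1..Suc n}. y i - z) / (\<Prod>i\<in>{1..Suc n + 1}. x i - z)"
    by (simp add: Fz v_def w_def mult_ac)
  finally show ?case .
qed

section \<open>Independence in products\<close>

lemma prob_pair_pmf_Times:
  "measure_pmf.prob (pair_pmf p q) (A \<times> B) = measure_pmf.prob p A * measure_pmf.prob q B"
proof -
  \<comment> \<open>The product formula used below is for countable sets, hence the restriction to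
    the supports.\<close>
  have "A \<times> B \<inter> set_pmf (pair_pmf p q) = (A \<inter> set_pmf p) \<times> (B \<inter> set_pmf q)"
    by auto
  then show ?thesis
    using measure_Int_set_pmf[of "pair_pmf p q" "A \<times> B"]
      measure_pmf_prob_product[of "A \<inter> set_pmf p" "B \<inter> set_pmf q" p q]
    by (simp add: measure_Int_set_pmf)
qed

text \<open>Invariance of \<open>Q\<close> under updates at \<open>i\<close> says that
  \<open>Q\<close> ignores this coordinate. Drawing coordinate \<open>i\<close> apart from the
  others makes the event a rectangle.\<close>

lemma prob_Pi_pmf_indep_component:
  assumes "finite A" "i \<in> A" "\<And>f v. Q (f(i := v)) \<longleftrightarrow> Q f"
  shows "measure_pmf.prob (Pi_pmf A d p) {f. Q f \<and> R (f i)} =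
    measure_pmf.prob (Pi_pmf A d p) {f. Q f} * measure_pmf.prob (p i) {v. R v}"
proof -
  define P where "P = pair_pmf (p i) (Pi_pmf (A - {i}) d p)"
  have Pi: "Pi_pmf A d p = map_pmf (\<lambda>(v, f). f(i := v)) P"
    unfolding P_def using Pi_pmf_insert[of "A - {i}" i d p] assms(1,2)
    by (simp add: insert_absorb)
  have *: "measure_pmf.prob (Pi_pmf A d p) {f. Q f \<and> S (f i)} =
      measure_pmf.prob (p i) {v. S v} * measure_pmf.prob (Pi_pmf (A - {i}) d p) {f. Q f}" for S
  proof -
    have "(\<lambda>(v, f). f(i := v)) -` {f. Q f \<and> S (f i)} = {v. S v} \<times> {f. Q f}"
      using assms(3) by auto
    then show ?thesis
      by (simp add: Pi P_def prob_pair_pmf_Times del: vimage_Collect_eq)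
  qed
  show ?thesis
    \<comment> \<open>The trivial condition shows that \<open>Q\<close> has the same probability
      with and without coordinate \<open>i\<close>.\<close>
    using *[of R] *[of "\<lambda>_. True"] by simp
qed

section \<open>Tuples of outcomes and the index of their part\<close>

lemma experiment_order_Suc:
  "experiment_order (Suc n) = experiment_order n @ map (\<lambda>k. (k, Suc n)) (rev [1..<n + 2])"
  by (simp add: experiment_order_def)

lemma set_experiment_order: "set (experiment_order n) = {(k, j). 1 \<le> k \<and> k \<le> j \<and> j \<le> n}"
  by (auto simp: experiment_order_def image_iff simp del: upt_Suc)

lemma length_experiment_order: "length (experiment_order n) = n * (n + 1) div 2"
proof (induction n)
  case 0
  then show ?case by (simp add: experiment_order_def)
next
  case (Suc n)
  have "Suc n * (Suc n + 1) = n * (n + 1) + 2 * (n + 1)"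
    by simp
  then have "Suc n * (Suc n + 1) div 2 = n * (n + 1) div 2 + (n + 1)"
    by simp
  then show ?case
    using Suc by (simp add: experiment_order_Suc)
qed

lemma take_experiment_order:
  "take (Suc n * (Suc n - 1) div 2) (map \<omega> (experiment_order (Suc n))) =
    map \<omega> (experiment_order n)"
  using length_experiment_order[of n]
  by (simp add: experiment_order_Suc mult.commute)

lemma map_in_listset:
  assumes "\<And>x. x \<in> set xs \<Longrightarrow> f x \<in> g x"
  shows "map f xs \<in> listset (map g xs)"
  using assms by (induction xs) (auto simp: set_Cons_def)

lemma entry_map:
  assumes "1 \<le> a" "a \<le> b" "b \<le> n"
  shows "entry n (map \<omega> (experiment_order n)) a b = \<omega> (a, b)"
  using assms by (simp add: entry_def map_of_zip_map set_experiment_order)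

text \<open>The Markov chain: its value at \<open>l\<close> is the \<open>j\<close> with the first
  \<open>l\<close> blocks of outcomes in the \<open>j\<close>-th part. The start \<open>1\<close>,
  before any experiment, makes the first step obey the general rule.\<close>

primrec part_index :: "diagram \<Rightarrow> (nat \<times> nat \<Rightarrow> diagram) \<Rightarrow> nat \<Rightarrow> nat" where
  "part_index D \<omega> 0 = 1"
| "part_index D \<omega> (Suc l) =
     (if \<omega> (part_index D \<omega> l, Suc l) = delete_box D (2 * Suc l) then l + 2
      else part_index D \<omega> l)"

lemma part_index_bounds: "1 \<le> part_index D \<omega> l" "part_index D \<omega> l \<le> l + 1"
  by (induction l) auto

text \<open>The first \<open>l\<close> steps read only pairs with second component at most
  \<open>l\<close>; this yields the independence of the next step.\<close>

lemma part_index_upd: "l < snd c \<Longrightarrow> part_index D (f(c := v)) l = part_index D f l"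
  by (induction l) auto

section \<open>Row lengths of the diagram\<close>

lemma length_interlaced_prefix:
  "length (concat (map (\<lambda>p. [m p, k p]) [1..<n + 1])) = 2 * n"
  by (induction n) auto

lemma nth_interlaced_prefix:
  assumes "p < n"
  shows "concat (map (\<lambda>p. [m p, k p]) [1..<n + 1]) ! (2 * p) = m (Suc p)"
    and "concat (map (\<lambda>p. [m p, k p]) [1..<n + 1]) ! Suc (2 * p) = k (Suc p)"
proof -
  have "concat (map (\<lambda>p. [m p, k p]) [1..<n + 1]) ! (2 * p) = m (Suc p) \<and>
      concat (map (\<lambda>p. [m p, k p]) [1..<n + 1]) ! Suc (2 * p) = k (Suc p)"
    using assms
  proof (induction n)
    case (Suc n)
    have "concat (map (\<lambda>p. [m p, k p]) [1..<Suc n + 1]) =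
        concat (map (\<lambda>p. [m p, k p]) [1..<n + 1]) @ [m (Suc n), k (Suc n)]"
      by simp
    then show ?case
      using Suc length_interlaced_prefix[of m k n]
      by (cases "p = n") (auto simp: nth_append simp del: upt_Suc)
  qed simp
  then show "concat (map (\<lambda>p. [m p, k p]) [1..<n + 1]) ! (2 * p) = m (Suc p)"
    and "concat (map (\<lambda>p. [m p, k p]) [1..<n + 1]) ! Suc (2 * p) = k (Suc p)"
    by auto
qed

locale interlaced =
  fixes n :: nat and m k :: "nat \<Rightarrow> int"
  assumes interlacing: "\<And>p. 1 \<le> p \<Longrightarrow> p \<le> n \<Longrightarrow> m p \<ge> k p \<and> k p \<ge> m (p + 1)"
begin

definition D :: diagram where "D = interlaced_diagram n m k"

definition x :: "nat \<Rightarrow> real" where "x i = m i - int i"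

definition y :: "nat \<Rightarrow> real" where "y i = k i - int i - 1"

lemma length_D: "length D = 2 * n + 1"
  using length_interlaced_prefix[of m k n] by (simp add: D_def interlaced_diagram_def)

lemma row_len_D_odd:
  assumes "1 \<le> p" "p \<le> n + 1"
  shows "row_len D (2 * p - 1) = m p"
proof -
  obtain q where q: "p = Suc q"
    using assms(1) by (cases p) auto
  show ?thesis
    using assms(2) nth_interlaced_prefix(1)[of q n m k] length_interlaced_prefix[of m k n]
    \<comment> \<open>For \<open>q = n\<close> the row is the last one, appended after the prefix of
      length \<open>2 * n\<close>.\<close>
    by (cases "q = n") (auto simp: row_len_def D_def interlaced_diagram_def q nth_append simp del: upt_Suc)
qed

lemma row_len_D_even:
  assumes "1 \<le> p" "p \<le> n"
  shows "row_len D (2 * p) = k p"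
proof -
  obtain q where q: "p = Suc q"
    using assms(1) by (cases p) auto
  show ?thesis
    using assms(2) nth_interlaced_prefix(2)[of q n m k] length_interlaced_prefix[of m k n]
    by (auto simp: row_len_def D_def interlaced_diagram_def q nth_append simp del: upt_Suc)
qed

section \<open>Counting operations and telling outcomes apart\<close>

lemma operations_D:
  assumes "1 \<le> a" "b \<le> n"
  shows "operations D a b =
    (\<Union>p\<in>{a..b}. Insert p ` {k p..m p} \<union> Delete p ` {m (p + 1)<..k p})"
  unfolding operations_def
proof (rule SUP_cong[OF refl])
  fix p assume "p \<in> {a..b}"
  then show "Insert p ` {row_len D (2 * p)..row_len D (2 * p - 1)} \<union>
      Delete p ` {row_len D (2 * p + 1)<..row_len D (2 * p)} =
      Insert p ` {k p..m p} \<union> Delete p ` {m (p + 1)<..k p}"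
    using assms row_len_D_odd[of p] row_len_D_even[of p] row_len_D_odd[of "p + 1"] by simp
qed

lemma finite_operations_D: "finite (operations D a b)"
  by (auto simp: operations_def)

text \<open>In the count for one \<open>p\<close> the term \<open>k p\<close> cancels and the extra
  insertion is absorbed by the shift in \<open>x\<close>, so the sum over \<open>p\<close>
  telescopes.\<close>

lemma card_operations_D:
  assumes "1 \<le> a" "a \<le> b" "b \<le> n"
  shows "real (card (operations D a b)) = x a - x (b + 1)"
proof -
  have "card (operations D a b) =
      (\<Sum>p\<in>{a..b}. card (Insert p ` {k p..m p} \<union> Delete p ` {m (p + 1)<..k p}))"
    unfolding operations_D[OF assms(1,3)] by (rule card_UN_disjoint) auto
  also have "real \<dots> = (\<Sum>p\<in>{a..b}. x p - x (p + 1))"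
    unfolding of_nat_sum
  proof (rule sum.cong[OF refl])
    fix p assume p: "p \<in> {a..b}"
    have "card (Insert p ` {k p..m p} \<union> Delete p ` {m (p + 1)<..k p}) =
        card (Insert p ` {k p..m p}) + card (Delete p ` {m (p + 1)<..k p})"
      by (rule card_Un_disjoint) auto
    also have "\<dots> = nat (m p - k p + 1) + nat (k p - m (p + 1))"
      by (simp add: card_image inj_on_def)
    finally show "real (card (Insert p ` {k p..m p} \<union> Delete p ` {m (p + 1)<..k p})) =
        x p - x (p + 1)"
      using interlacing[of p] p assms by (simp add: x_def)
  qed
  also have "\<dots> = x a - x (b + 1)"
    using sum_Suc_diff[of a b "\<lambda>p. - x p"] assms(2) by simp
  finally show ?thesis .
qed

text \<open>Outcomes are compared as diagrams, so coincidences between operations must be excluded: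
  only deletions with \<open>p = b\<close> change row \<open>2 * b\<close>.\<close>

lemma outcome_eq_delete_iff:
  assumes "1 \<le> a" "b \<le> n" "op \<in> operations D a b"
  shows "outcome D op = delete_box D (2 * b) \<longleftrightarrow> op \<in> Delete b ` {m (b + 1)<..k b}"
proof
  assume eq: "outcome D op = delete_box D (2 * b)"
  obtain p where p: "p \<in> {a..b}"
      "op \<in> Insert p ` {k p..m p} \<union> Delete p ` {m (p + 1)<..k p}"
    using assms(3) unfolding operations_D[OF assms(1,2)] by blast
  have "delete_box D (2 * b) ! (2 * b - 1) = k b - 1"
    using p assms row_len_D_even[of b] by (simp add: delete_box_def length_D)
  then have changed: "outcome D op ! (2 * b - 1) \<noteq> row_len D (2 * b)"
    using p assms row_len_D_even[of b] by (simp add: eq)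
  show "op \<in> Delete b ` {m (b + 1)<..k b}"
  proof (cases op)
    case (Insert q c)
    \<comment> \<open>Insertions change odd rows, which sit at even list positions.\<close>
    then have "outcome D op ! (2 * b - 1) = row_len D (2 * b)"
      using p assms(1) by (auto simp: add_box_def row_len_def)
    with changed show ?thesis by simp
  next
    case (Delete q c)
    have "p = b"
    proof (rule ccontr)
      assume "p \<noteq> b"
      then have "outcome D op ! (2 * b - 1) = row_len D (2 * b)"
        using p assms(1) Delete by (auto simp: delete_box_def row_len_def)
      with changed show False by simp
    qed
    with p Delete show ?thesis by auto
  qed
qed auto

text \<open>The difference counts the operations of the experiment \<open>(a, b - 1)\<close>, and
  inserting directly after the first \<open>k a\<close> boxes is always one of them.\<close>

lemma x_less:
  assumes "1 \<le> a" "a < b" "b \<le> n + 1"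
  shows "x b < x a"
proof -
  have "Insert a (k a) \<in> operations D a (b - 1)"
    using assms interlacing[of a] by (subst operations_D) (auto intro!: bexI[of _ a])
  then have "card (operations D a (b - 1)) > 0"
    using finite_operations_D by (auto simp: card_gt_0_iff)
  moreover have "a \<le> b - 1" "b - 1 \<le> n"
    using assms by auto
  ultimately show ?thesis
    using card_operations_D[of a "b - 1"] assms by simp
qed

lemma operations_D_nonempty:
  assumes "1 \<le> a" "a \<le> b" "b \<le> n"
  shows "operations D a b \<noteq> {}"
  using card_operations_D[OF assms] x_less[of a "b + 1"] assms by auto

section \<open>A single experiment\<close>

lemma prob_delete:
  assumes "1 \<le> a" "a \<le> b" "b \<le> n"
  shows "measure_pmf.prob (elementary_experiment D a b) {v. v = delete_box D (2 * b)} =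
    (y b - x (b + 1)) / (x a - x (b + 1))"
proof -
  have "Delete b ` {m (b + 1)<..k b} \<subseteq> operations D a b"
    using assms by (subst operations_D) auto
  then have "operations D a b \<inter> outcome D -` {v. v = delete_box D (2 * b)} =
      Delete b ` {m (b + 1)<..k b}"
    using outcome_eq_delete_iff[OF assms(1,3)] by blast
  then have "measure_pmf.prob (elementary_experiment D a b) {v. v = delete_box D (2 * b)} =
      real (card (Delete b ` {m (b + 1)<..k b})) / real (card (operations D a b))"
    using operations_D_nonempty[OF assms]
    by (simp add: elementary_experiment_def measure_pmf_of_set finite_operations_D)
  also have "card (Delete b ` {m (b + 1)<..k b}) = nat (k b - m (b + 1))"
    by (simp add: card_image inj_on_def)
  also have "real \<dots> = y b - x (b + 1)"
    using interlacing[of b] assms by (simp add: x_def y_def)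
  finally show ?thesis
    by (simp add: card_operations_D[OF assms])
qed

text \<open>Numerator and denominator are both negated so that this is the factor in
  \<open>interlacing_weight_Suc\<close>.\<close>

lemma prob_not_delete:
  assumes "1 \<le> a" "a \<le> b" "b \<le> n"
  shows "measure_pmf.prob (elementary_experiment D a b) {v. v \<noteq> delete_box D (2 * b)} =
    (y b - x a) / (x (b + 1) - x a)"
proof -
  have "{v. v \<noteq> delete_box D (2 * b)} = - {v. v = delete_box D (2 * b)}"
    by auto
  then have "measure_pmf.prob (elementary_experiment D a b) {v. v \<noteq> delete_box D (2 * b)} =
      1 - (y b - x (b + 1)) / (x a - x (b + 1))"
    using measure_pmf.prob_compl[of "{v. v = delete_box D (2 * b)}" "elementary_experiment D a b"]
      prob_delete[OF assms] by (simp add: Compl_eq_Diff_UNIV)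
  then show ?thesis
    using x_less[of a "b + 1"] assms by (simp add: divide_simps) (simp add: algebra_simps)
qed

section \<open>Distribution of the index\<close>

definition outcomes :: "(nat \<times> nat \<Rightarrow> diagram) pmf" where
  "outcomes = Pi_pmf (set (experiment_order n)) undefined (\<lambda>(a, b). elementary_experiment D a b)"

text \<open>Once the current index \<open>a\<close> is fixed, the next step reads the fixed
  coordinate \<open>(a, Suc l)\<close>, on which the first \<open>l\<close> steps do not
  depend.\<close>

lemma prob_outcomes_step:
  assumes "1 \<le> a" "a \<le> Suc l" "Suc l \<le> n"
  shows "measure_pmf.prob outcomes {\<omega>. part_index D \<omega> l = a \<and> R (\<omega> (a, Suc l))} =
    measure_pmf.prob outcomes {\<omega>. part_index D \<omega> l = a} *
    measure_pmf.prob (elementary_experiment D a (Suc l)) {v. R v}"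
proof -
  have "(a, Suc l) \<in> set (experiment_order n)"
    using assms by (simp add: set_experiment_order)
  then show ?thesis
    unfolding outcomes_def
    by (subst prob_Pi_pmf_indep_component) (auto simp: part_index_upd)
qed

lemma prob_part_index:
  assumes "l \<le> n" "1 \<le> j" "j \<le> l + 1"
  shows "measure_pmf.prob outcomes {\<omega>. part_index D \<omega> l = j} = interlacing_weight x y l j"
  using assms
proof (induction l arbitrary: j)
  case 0
  then have "j = 1" by simp
  then show ?case
    using interlacing_weight_0[of x y] by simp
next
  case (Suc l)
  show ?case
  proof (cases "j = l + 2")
    case False
    then have j: "1 \<le> j" "j \<le> l + 1"
      using Suc.prems by auto
    \<comment> \<open>A jump leads to \<open>l + 2\<close> only, so an old index is reached by
      staying.\<close>
    have "{\<omega>. part_index D \<omega> (Suc l) = j} =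
        {\<omega>. part_index D \<omega> l = j \<and> \<omega> (j, Suc l) \<noteq> delete_box D (2 * Suc l)}"
      using False by auto
    then show ?thesis
      using prob_outcomes_step[of j l "\<lambda>v. v \<noteq> delete_box D (2 * Suc l)"] Suc j
        prob_not_delete[of j "Suc l"] interlacing_weight_Suc[OF j, of x y]
      by simp
  next
    case True
    let ?A = "\<lambda>a. {\<omega>. part_index D \<omega> l = a \<and> \<omega> (a, Suc l) = delete_box D (2 * Suc l)}"
    have "{\<omega>. part_index D \<omega> (Suc l) = j} = (\<Union>a\<in>{1..l + 1}. ?A a)"
    proof -
      \<comment> \<open>The previous index is at most \<open>l + 1\<close>, so \<open>l + 2\<close>
        is reached only by a jump.\<close>
      have "part_index D \<omega> l \<in> {1..l + 1}" "part_index D \<omega> l \<noteq> l + 2" for \<omega>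
        using part_index_bounds[of D \<omega> l] by auto
      then show ?thesis
        by (auto simp: True split: if_splits)
    qed
    then have "measure_pmf.prob outcomes {\<omega>. part_index D \<omega> (Suc l) = j} =
        (\<Sum>a\<in>{1..l + 1}. measure_pmf.prob outcomes (?A a))"
      using measure_pmf.finite_measure_finite_Union[of "{1..l + 1}" ?A outcomes]
      by (auto simp: disjoint_family_on_def)
    also have "\<dots> = (\<Sum>a\<in>{1..l + 1}.
        (y (Suc l) - x (l + 2)) * (interlacing_weight x y l a / (x a - x (l + 2))))"
    proof (rule sum.cong[OF refl])
      fix a assume a: "a \<in> {1..l + 1}"
      then show "measure_pmf.prob outcomes (?A a) =
          (y (Suc l) - x (l + 2)) * (interlacing_weight x y l a / (x a - x (l + 2)))"
        using prob_outcomes_step[of a l "\<lambda>v. v = delete_box D (2 * Suc l)"] Suc.prems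
          Suc.IH[of a] prob_delete[of a "Suc l"] by simp
    qed
    also have "\<dots> = interlacing_weight x y (Suc l) (l + 2)"
    proof -
      have "inj_on x {1..l + 1}"
        using x_less Suc.prems(1) by (intro linorder_inj_onI) (force dest: less_imp_neq)+
      moreover have "x i \<noteq> x (l + 2)" if "i \<in> {1..l + 1}" for i
        using x_less[of i "l + 2"] that Suc.prems(1) by auto
      ultimately show ?thesis
        unfolding interlacing_weight_Suc_last sum_distrib_left[symmetric]
        by (subst interlacing_weight_partial_fractions) auto
    qed
    finally show ?thesis
      using True by simp
  qed
qed

section \<open>The parts of the sample space in terms of the index\<close>

lemma outcomes_possible:
  assumes "\<omega> \<in> set_pmf outcomes" "1 \<le> a" "a \<le> b" "b \<le> n"
  shows "\<omega> (a, b) \<in> outcome D ` operations D a b"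
proof -
  have "(a, b) \<in> set (experiment_order n)"
    using assms by (simp add: set_experiment_order)
  then have "\<omega> (a, b) \<in> set_pmf (elementary_experiment D a b)"
    using assms(1) by (auto simp: outcomes_def set_Pi_pmf PiE_dflt_def)
  then show ?thesis
    using operations_D_nonempty[OF assms(2-4)]
    by (simp add: elementary_experiment_def finite_operations_D)
qed

lemma in_sample_space:
  assumes "\<omega> \<in> set_pmf outcomes" "l \<le> n"
  shows "map \<omega> (experiment_order l) \<in> sample_space D l"
  unfolding sample_space_def
proof (rule map_in_listset)
  fix c assume "c \<in> set (experiment_order l)"
  then show "\<omega> c \<in> (case c of (a, b) \<Rightarrow> outcome D ` operations D a b)"
    using assms by (auto simp: set_experiment_order intro!: outcomes_possible)
qed

text \<open>The recursion for the parts is the transition rule of the chain; the support condition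
  supplies membership in \<open>sample_space\<close>.\<close>

lemma in_sample_part_iff:
  assumes "\<omega> \<in> set_pmf outcomes" "Suc l \<le> n" "1 \<le> j" "j \<le> l + 2"
  shows "map \<omega> (experiment_order (Suc l)) \<in> sample_part D (Suc l) j \<longleftrightarrow>
    part_index D \<omega> (Suc l) = j"
  using assms(2-)
proof (induction l arbitrary: j)
  case 0
  have entry: "entry 1 (map \<omega> (experiment_order 1)) 1 1 = \<omega> (1, 1)"
    by (rule entry_map) auto
  obtain op where op: "op \<in> operations D 1 1" "\<omega> (1, 1) = outcome D op"
    using outcomes_possible[OF assms(1), of 1 1] 0 by auto
  have ops: "operations D 1 1 = Insert 1 ` {k 1..m 1} \<union> Delete 1 ` {m 2<..k 1}"
    using operations_D[of 1 1] 0 by (simp add: numeral_2_eq_2)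
  have iff: "\<omega> (1, 1) = delete_box D 2 \<longleftrightarrow> op \<in> Delete 1 ` {m 2<..k 1}"
    using outcome_eq_delete_iff[of 1 1 op] op 0 by (simp add: numeral_2_eq_2)
  \<comment> \<open>The first part is defined by equality with \<open>add_box D 1\<close>, the chain
    by avoiding the deletion. They agree because this experiment has only two possible outcomes, and
    these differ.\<close>
  have "\<omega> (1, 1) = add_box D 1 \<longleftrightarrow> \<omega> (1, 1) \<noteq> delete_box D 2"
  proof
    assume "\<omega> (1, 1) = add_box D 1"
    moreover have "Insert 1 (k 1) \<in> operations D 1 1"
      using ops interlacing[of 1] 0 by auto
    ultimately show "\<omega> (1, 1) \<noteq> delete_box D 2"
      using outcome_eq_delete_iff[of 1 1 "Insert 1 (k 1)"] 0 by auto
  next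
    assume "\<omega> (1, 1) \<noteq> delete_box D 2"
    with iff op ops show "\<omega> (1, 1) = add_box D 1"
      by auto
  qed
  then show ?case
    using entry in_sample_space[OF assms(1), of 1] 0 by (auto simp: numeral_2_eq_2)
next
  case (Suc l)
  let ?xs = "map \<omega> (experiment_order (Suc (Suc l)))"
  have space: "?xs \<in> sample_space D (Suc (Suc l))"
    using in_sample_space[OF assms(1)] Suc.prems by blast
  have take: "take (Suc (Suc l) * (Suc (Suc l) - 1) div 2) ?xs = map \<omega> (experiment_order (Suc l))"
    by (rule take_experiment_order)
  have IH: "map \<omega> (experiment_order (Suc l)) \<in> sample_part D (Suc l) a \<longleftrightarrow>
      part_index D \<omega> (Suc l) = a" if "1 \<le> a" "a \<le> l + 2" for a
    using Suc.IH that Suc.prems by simp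
  have entry: "entry (Suc (Suc l)) ?xs a (Suc (Suc l)) = \<omega> (a, Suc (Suc l))"
    if "1 \<le> a" "a \<le> l + 2" for a
    by (rule entry_map) (use that in auto)
  show ?case
  proof (cases "j = l + 3")
    \<comment> \<open>The level is \<open>l + 2\<close>, so \<open>l + 3\<close> is the index of the
      part defined as a union.\<close>
    case True
    have "?xs \<in> sample_part D (Suc (Suc l)) j \<longleftrightarrow>
        (\<exists>a\<in>{1..l + 2}. part_index D \<omega> (Suc l) = a \<and>
          \<omega> (a, Suc (Suc l)) = delete_box D (2 * Suc (Suc l)))"
      using True space take IH entry by (simp add: Let_def del: part_index.simps)
    also have "\<dots> \<longleftrightarrow> part_index D \<omega> (Suc (Suc l)) = j"
      using True part_index_bounds[of D \<omega> "Suc l"]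
      by (auto simp del: part_index.simps(2) simp: part_index.simps(2)[of D \<omega> "Suc l"])
    finally show ?thesis .
  next
    case False
    then have j: "1 \<le> j" "j \<le> l + 2"
      using Suc.prems by auto
    have "?xs \<in> sample_part D (Suc (Suc l)) j \<longleftrightarrow>
        part_index D \<omega> (Suc l) = j \<and> \<omega> (j, Suc (Suc l)) \<noteq> delete_box D (2 * Suc (Suc l))"
      using j space take IH[OF j] entry[OF j] by (simp add: Let_def del: part_index.simps)
    also have "\<dots> \<longleftrightarrow> part_index D \<omega> (Suc (Suc l)) = j"
      using False part_index_bounds[of D \<omega> "Suc l"]
      by (auto simp del: part_index.simps(2) simp: part_index.simps(2)[of D \<omega> "Suc l"])
    finally show ?thesis .
  qed
qed

lemma prob_sample_part:
  assumes "n \<ge> 1" "1 \<le> j" "j \<le> n + 1"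
  shows "measure_pmf.prob (complete_experiment D n) (sample_part D n j) =
    interlacing_weight x y n j"
proof -
  obtain l where l: "n = Suc l"
    using assms(1) by (cases n) auto
  have "measure_pmf.prob (complete_experiment D n) (sample_part D n j) =
      measure_pmf.prob outcomes ((\<lambda>\<omega>. map \<omega> (experiment_order n)) -` sample_part D n j)"
    by (simp add: complete_experiment_def outcomes_def)
  also have "\<dots> = measure_pmf.prob outcomes {\<omega>. part_index D \<omega> n = j}"
    using in_sample_part_iff[of _ l j] assms l
    \<comment> \<open>The two events are compared on the support only, hence almost
      everywhere.\<close>
    by (intro measure_pmf.finite_measure_eq_AE) (auto simp: AE_measure_pmf_iff simp del: part_index.simps)
  also have "\<dots> = interlacing_weight x y n j"
    using prob_part_index[of n j] assms by simp
  finally show ?thesis .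
qed

end

theorem theorem7p1:
  fixes n j :: nat and m k :: "nat \<Rightarrow> int" and D :: diagram
  assumes "n \<ge> 1"
    and "\<And>p. 1 \<le> p \<Longrightarrow> p \<le> n \<Longrightarrow> m p \<ge> k p \<and> k p \<ge> m (p + 1)"
    and "m (n + 1) \<ge> 0"
    and "D = interlaced_diagram n m k"
    and "1 \<le> j" and "j \<le> n + 1"
  shows "measure_pmf.prob (complete_experiment D n) (sample_part D n j) =
    \<bar>(\<Prod>i\<in>{1..n}. real_of_int (k i - m j - int i + int j - 1)) /
     (\<Prod>i\<in>{1..n + 1} - {j}. real_of_int (m i - m j - int i + int j))\<bar>"
proof -
  interpret I: interlaced n m k
    by unfold_locales (rule assms(2))
  have prob: "measure_pmf.prob (complete_experiment D n) (sample_part D n j) =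
      interlacing_weight I.x I.y n j"
    using I.prob_sample_part assms by (simp add: I.D_def)
  have "interlacing_weight I.x I.y n j =
      (\<Prod>i\<in>{1..n}. real_of_int (k i - m j - int i + int j - 1)) /
      (\<Prod>i\<in>{1..n + 1} - {j}. real_of_int (m i - m j - int i + int j))"
    unfolding interlacing_weight_def I.x_def I.y_def
    by (intro arg_cong2[where f = "(/)"] prod.cong) auto
  moreover have "interlacing_weight I.x I.y n j \<ge> 0"
    unfolding prob[symmetric] by simp
  ultimately show ?thesis
    using prob by (simp only: abs_of_nonneg)
qed

end
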